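(* Let $G$ be a graph with bounded degree and let $w:\mathbb N\to(0,\infty)$ satisfy $\sum_{n=0}^\infty 1/w(n)<\infty$. Then almost surely the vertex-reinforced random walk on $G$ with weight $w$ visits only a finite number of sites.
   Context: Given a locally finite graph $G$ (each vertex having at least one neighbour), a weight $w:\mathbb N\to(0,\infty)$ and a starting vertex $X_0$, the vertex-reinforced random walk (VRRW) $(X_n)_{n\ge0}$ on $G$ with weight $w$ is the process with $$\mathbb P(X_{n+1}=y\mid\mathcal F_n)=\frac{w(Z_n(y))}{\sum_{z\sim X_n}w(Z_n(z))}\mathbf 1_{\{X_n\sim y\}},$$ where $\mathcal F_n=\sigma(X_k;k\le n)$, $Z_n(y)=\sum_{\ell=0}^n\mathbf 1_{\{X_\ell=y\}}$, and $x\sim y$ means that $x$ and $y$ are neighbours in $G$. *)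

theory Defs
  imports "HOL-Probability.Probability"
begin

definition nbrs :: "('a \<Rightarrow> 'a \<Rightarrow> bool) \<Rightarrow> 'a \<Rightarrow> 'a set" where
  "nbrs adj x = {y. adj x y}"

text \<open>Transition probability of the VRRW given the history h = [X_0, ..., X_n]
  (nonempty) to the vertex y.  Here Z_n(y) = count_list h y.\<close>
definition vrrw_step :: "('a \<Rightarrow> 'a \<Rightarrow> bool) \<Rightarrow> (nat \<Rightarrow> real) \<Rightarrow> 'a list \<Rightarrow> 'a \<Rightarrow> real" where
  "vrrw_step adj w h y =
     (if adj (last h) y
      then w (count_list h y) / (\<Sum>z\<in>nbrs adj (last h). w (count_list h z))
      else 0)"

definition vrrw_path_prob :: "('a \<Rightarrow> 'a \<Rightarrow> bool) \<Rightarrow> (nat \<Rightarrow> real) \<Rightarrow> 'a \<Rightarrow> 'a list \<Rightarrow> real" where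
  "vrrw_path_prob adj w x0 xs =
     (if hd xs = x0 then 1 else 0) *
     (\<Prod>k\<in>{1..<length xs}. vrrw_step adj w (take k xs) (xs ! k))"

definition is_vrrw :: "'m measure \<Rightarrow> ('a \<Rightarrow> 'a \<Rightarrow> bool) \<Rightarrow> (nat \<Rightarrow> real) \<Rightarrow> 'a
                       \<Rightarrow> (nat \<Rightarrow> 'm \<Rightarrow> 'a) \<Rightarrow> bool" where
  "is_vrrw M adj w x0 X \<longleftrightarrow>
     prob_space M \<and>
     (\<forall>n. X n \<in> measurable M (count_space UNIV)) \<and>
     (\<forall>xs. xs \<noteq> [] \<longrightarrow>
        measure M {\<omega> \<in> space M. \<forall>k<length xs. X k \<omega> = xs ! k} = vrrw_path_prob adj w x0 xs)"

end

theory Submission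
  imports Defs
begin

text \<open>
  Let R be the number of sites visited up to time N; we bound its mean uniformly in N.  Call a time
  k-low if every neighbour of the current site has been visited fewer than k times, and k-high
  otherwise.

  A step at which x is left decreases the remaining weight (the sum of 1/w(i) over i at least
  Z(y)) of each neighbour y of x by the same mean amount 1/S, where S is the normalising sum at x.
  Hence the mean of the sum of 1/S over the k-high times is at most E R times the k-th tail of the
  series of 1/w, and the mean number of steps that leave a k-high time for a site visited at most j
  times is at most a constant c(j), not depending on k, times this bound.  On the other hand, at
  two consecutive l-low times the walk has a chance bounded below to alternate for ever between the
  two current sites, so the mean number of such pairs is bounded.

  Fix k and then a much larger l.  New sites found from k-high times account for at most R/4 in the
  mean; those found from k-low times form an l-low pair, or else lead to an l-high time.  After the
  latter, the walk must pass from a k-high to a k-low time before it does so again; such a passage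
  either forms an l-low pair or goes from an l-high time to a site visited at most D k times, which
  again accounts for at most R/4.  So E R is at most a constant plus E R / 2.
\<close>

locale reinforced_walk =
  fixes adj :: "'a \<Rightarrow> 'a \<Rightarrow> bool" and w :: "nat \<Rightarrow> real" and x0 :: 'a and D :: nat
  assumes sym: "\<And>x y. adj x y \<Longrightarrow> adj y x"
    and irrefl: "\<And>x. \<not> adj x x"
    and loc_finite: "\<And>x. finite (nbrs adj x)"
    and has_nbr: "\<And>x. nbrs adj x \<noteq> {}"
    and degree: "\<And>x. card (nbrs adj x) \<le> D"
    and w_pos: "\<And>n. w n > 0"
    and summable: "summable (\<lambda>n. 1 / w n)"
begin

section \<open>Finite histories and means over them\<close>

definition local_weight :: "'a list \<Rightarrow> real" where
  "local_weight h = (\<Sum>z\<in>nbrs adj (last h). w (count_list h z))"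

text \<open>Walks of N steps from \<open>x0\<close>. All other histories of that length have
  probability 0, so the finite sum \<open>path_mean N\<close> is the expectation under the law of
  the VRRW up to time N, and no measure space is needed before
  \<open>AE_finite_range\<close>.\<close>

primrec paths :: "nat \<Rightarrow> 'a list set" where
  "paths 0 = {[x0]}"
| "paths (Suc N) = (\<lambda>(h, y). h @ [y]) ` Sigma (paths N) (\<lambda>h. nbrs adj (last h))"

definition path_mean :: "nat \<Rightarrow> ('a list \<Rightarrow> real) \<Rightarrow> real" where
  "path_mean N f = (\<Sum>h\<in>paths N. vrrw_path_prob adj w x0 h * f h)"

definition step_mean :: "('a list \<Rightarrow> 'a \<Rightarrow> real) \<Rightarrow> 'a list \<Rightarrow> real" where
  "step_mean c h = (\<Sum>y\<in>nbrs adj (last h). vrrw_step adj w h y * c h y)"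

definition path_sum :: "('a list \<Rightarrow> 'a \<Rightarrow> real) \<Rightarrow> 'a list \<Rightarrow> real" where
  "path_sum c h = (\<Sum>t\<in>{1..<length h}. c (take t h) (h ! t))"

definition low :: "nat \<Rightarrow> 'a list \<Rightarrow> bool" where
  "low k h \<longleftrightarrow> (\<forall>z\<in>nbrs adj (last h). count_list h z < k)"

definition tail :: "nat \<Rightarrow> real" where
  "tail n = (\<Sum>j. 1 / w (j + n))"

lemma local_weight_pos: "local_weight h > 0"
  unfolding local_weight_def by (rule sum_pos) (use loc_finite has_nbr w_pos in auto)

lemma step_eq: "y \<in> nbrs adj (last h) \<Longrightarrow> vrrw_step adj w h y = w (count_list h y) / local_weight h"
  by (auto simp: vrrw_step_def nbrs_def local_weight_def)

lemma step_nonneg: "vrrw_step adj w h y \<ge> 0"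
proof -
  have "0 \<le> local_weight h" "0 \<le> w (count_list h y)"
    using local_weight_pos w_pos by (auto intro: less_imp_le)
  then show ?thesis by (auto simp: vrrw_step_def local_weight_def[symmetric])
qed

lemma step_sum: "(\<Sum>y\<in>nbrs adj (last h). vrrw_step adj w h y) = 1"
proof -
  have "(\<Sum>y\<in>nbrs adj (last h). vrrw_step adj w h y)
      = (\<Sum>y\<in>nbrs adj (last h). w (count_list h y) / local_weight h)"
    by (intro sum.cong) (auto simp: step_eq)
  also have "\<dots> = local_weight h / local_weight h"
    by (simp only: local_weight_def sum_divide_distrib)
  finally show ?thesis using local_weight_pos[of h] by simp
qed

lemma step_mean_mono:
  assumes "\<And>y. y \<in> nbrs adj (last h) \<Longrightarrow> c h y \<le> d h y"
  shows "step_mean c h \<le> step_mean d h"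
  unfolding step_mean_def by (intro sum_mono mult_left_mono assms step_nonneg)

lemma step_mean_add: "step_mean (\<lambda>h y. c h y + d h y) h = step_mean c h + step_mean d h"
  by (simp add: step_mean_def algebra_simps sum.distrib)

lemma step_mean_cmult: "step_mean (\<lambda>h y. a * c h y) h = a * step_mean c h"
  by (simp add: step_mean_def algebra_simps sum_distrib_left)

lemma step_mean_const: "step_mean (\<lambda>h y. c h) h = c h"
  by (simp add: step_mean_def sum_distrib_right[symmetric] step_sum)

lemma finite_paths: "finite (paths N)"
  by (induction N) (auto simp: loc_finite)

lemma length_paths: "h \<in> paths N \<Longrightarrow> length h = Suc N"
  by (induction N arbitrary: h) auto

lemma paths_not_Nil: "h \<in> paths N \<Longrightarrow> h \<noteq> []"
  using length_paths by force

lemma take_paths: "h \<in> paths N \<Longrightarrow> m \<le> N \<Longrightarrow> take (Suc m) h \<in> paths m"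
proof (induction N arbitrary: h)
  case (Suc N)
  then obtain g y where g: "g \<in> paths N" "h = g @ [y]" by auto
  show ?case
  proof (cases "m = Suc N")
    case True
    then show ?thesis using Suc.prems(1) length_paths[OF Suc.prems(1)] by simp
  next
    case False
    then show ?thesis using Suc.IH[OF g(1)] Suc.prems(2) g length_paths[OF g(1)] by simp
  qed
qed simp

lemma path_prob_snoc:
  assumes "h \<noteq> []"
  shows "vrrw_path_prob adj w x0 (h @ [y]) = vrrw_path_prob adj w x0 h * vrrw_step adj w h y"
proof -
  have "{1..<length (h @ [y])} = insert (length h) {1..<length h}"
    using assms by (auto simp: Suc_le_eq)
  then show ?thesis using assms
    by (auto simp: vrrw_path_prob_def nth_append intro!: prod.cong)
qed

lemma path_prob_nonneg: "vrrw_path_prob adj w x0 h \<ge> 0"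
  unfolding vrrw_path_prob_def by (intro mult_nonneg_nonneg prod_nonneg) (auto simp: step_nonneg)

lemma path_mean_0: "path_mean 0 f = f [x0]"
  by (simp add: path_mean_def vrrw_path_prob_def)

text \<open>Tower property, conditioning on the history up to time N.\<close>

lemma path_mean_Suc: "path_mean (Suc N) f = path_mean N (step_mean (\<lambda>h y. f (h @ [y])))"
proof -
  have inj: "inj_on (\<lambda>(h, y). h @ [y]) A" for A :: "('a list \<times> 'a) set"
    by (auto simp: inj_on_def)
  have "path_mean (Suc N) f = (\<Sum>(h, y)\<in>Sigma (paths N) (\<lambda>h. nbrs adj (last h)).
      vrrw_path_prob adj w x0 (h @ [y]) * f (h @ [y]))"
    unfolding path_mean_def paths.simps sum.reindex[OF inj] by (simp add: case_prod_unfold)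
  also have "\<dots> = (\<Sum>h\<in>paths N. \<Sum>y\<in>nbrs adj (last h). vrrw_path_prob adj w x0 (h @ [y]) * f (h @ [y]))"
    by (subst sum.Sigma) (auto simp: finite_paths loc_finite)
  also have "\<dots> = path_mean N (step_mean (\<lambda>h y. f (h @ [y])))"
    unfolding path_mean_def step_mean_def
    by (intro sum.cong) (auto simp: sum_distrib_left path_prob_snoc paths_not_Nil mult.assoc)
  finally show ?thesis .
qed

lemma path_mean_mono:
  assumes "\<And>h. h \<in> paths N \<Longrightarrow> f h \<le> g h"
  shows "path_mean N f \<le> path_mean N g"
  unfolding path_mean_def by (intro sum_mono mult_left_mono assms path_prob_nonneg)

lemma path_mean_add: "path_mean N (\<lambda>h. f h + g h) = path_mean N f + path_mean N g"
  by (simp add: path_mean_def algebra_simps sum.distrib)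

lemma path_mean_cmult: "path_mean N (\<lambda>h. a * f h) = a * path_mean N f"
  by (simp add: path_mean_def algebra_simps sum_distrib_left)

lemma path_mean_const: "path_mean N (\<lambda>h. a) = a"
proof (induction N)
  case (Suc N)
  have "step_mean (\<lambda>h y. a) = (\<lambda>h. a)" by (rule ext) (rule step_mean_const)
  then show ?case using Suc by (simp add: path_mean_Suc)
qed (simp add: path_mean_0)

lemma path_sum_single: "path_sum c [x] = 0"
  by (simp add: path_sum_def)

lemma path_sum_snoc: "h \<noteq> [] \<Longrightarrow> path_sum c (h @ [y]) = path_sum c h + c h y"
proof -
  assume "h \<noteq> []"
  then have "{1..<length (h @ [y])} = insert (length h) {1..<length h}"
    by (auto simp: Suc_le_eq)
  then show ?thesis
    by (auto simp: path_sum_def nth_append intro!: sum.cong)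
qed

text \<open>By \<open>drift\<close>, \<open>f\<close> minus \<open>path_sum c\<close> is a
  submartingale, and it starts at a nonnegative value. The mean bounds on descents and on low pairs
  both come from a suitable potential \<open>f\<close>.\<close>

lemma path_mean_path_sum_le:
  assumes drift: "\<And>N h. h \<in> paths N \<Longrightarrow> step_mean c h \<le> step_mean (\<lambda>h y. f (h @ [y])) h - f h"
    and "f [x0] \<ge> 0"
  shows "path_mean N (path_sum c) \<le> path_mean N f"
proof (induction N)
  case 0
  then show ?case using assms(2) by (simp add: path_mean_0 path_sum_single)
next
  case (Suc N)
  have "step_mean (\<lambda>h y. path_sum c (h @ [y])) h = path_sum c h + step_mean c h"
    if "h \<in> paths N" for h
  proof -
    have "step_mean (\<lambda>h y. path_sum c (h @ [y])) h = step_mean (\<lambda>h y. path_sum c h + c h y) h"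
      unfolding step_mean_def using path_sum_snoc[OF paths_not_Nil[OF that]] by simp
    then show ?thesis by (simp add: step_mean_add step_mean_const)
  qed
  then have "path_mean (Suc N) (path_sum c) \<le> path_mean N (\<lambda>h. path_sum c h + step_mean c h)"
    unfolding path_mean_Suc by (intro path_mean_mono) simp
  also have "\<dots> \<le> path_mean N f + path_mean N (step_mean c)"
    using Suc by (simp add: path_mean_add)
  also have "\<dots> = path_mean N (\<lambda>h. f h + step_mean c h)"
    by (simp add: path_mean_add)
  also have "\<dots> \<le> path_mean (Suc N) f"
    unfolding path_mean_Suc
  proof (rule path_mean_mono)
    fix h assume "h \<in> paths N"
    from drift[OF this] show "f h + step_mean c h \<le> step_mean (\<lambda>h y. f (h @ [y])) h" by simp
  qed
  finally show ?case .
qed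

section \<open>Tails of the series of 1/w\<close>

lemma tail_Suc: "tail n = 1 / w n + tail (Suc n)"
proof -
  have "summable (\<lambda>j. 1 / w (j + n))" using summable by (subst summable_iff_shift)
  from suminf_split_head[OF this] show ?thesis by (simp add: tail_def)
qed

lemma tail_nonneg: "tail n \<ge> 0"
  unfolding tail_def
  by (intro suminf_nonneg) (use summable w_pos in \<open>auto simp: summable_iff_shift[of "\<lambda>n. 1 / w n"] intro: less_imp_le\<close>)

lemma tail_le: "m \<le> n \<Longrightarrow> tail n \<le> tail m"
proof (induction n rule: dec_induct)
  case (step n)
  have "0 < 1 / w n" using w_pos by simp
  then show ?case using step tail_Suc[of n] by linarith
qed simp

lemma tail_tendsto: "tail \<longlonglongrightarrow> 0"
  unfolding tail_def using suminf_exist_split2[OF summable] .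

lemma sum_le_tail: "(\<Sum>j\<in>{k..<n}. 1 / w j) \<le> tail k"
proof (cases "k \<le> n")
  case True
  then have "(\<Sum>j\<in>{k..<n}. 1 / w j) + tail n = tail k"
  proof (induction n rule: dec_induct)
    case (step n)
    then show ?case using tail_Suc[of n] by simp
  qed simp
  then show ?thesis using tail_nonneg[of n] by linarith
qed (use tail_nonneg in simp)

section \<open>Visit counts of neighbouring sites\<close>

lemma count_snoc: "count_list (h @ [y]) z = count_list h z + (if y = z then 1 else 0)"
  by simp

text \<open>Each departure from x goes to a neighbour of x.\<close>
lemma count_le:
  "h \<in> paths N \<Longrightarrow> count_list h x \<le> (if x = last h then 1 else 0) + (\<Sum>z\<in>nbrs adj x. count_list h z)"
proof (induction N arbitrary: h)
  case (Suc N)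
  then obtain g y where g: "g \<in> paths N" "h = g @ [y]" "adj (last g) y" by (auto simp: nbrs_def)
  have "(\<Sum>z\<in>nbrs adj x. count_list h z)
     = (\<Sum>z\<in>nbrs adj x. count_list g z) + (if y \<in> nbrs adj x then 1 else 0)"
    using loc_finite by (simp only: g count_snoc sum.distrib sum.delta')
  moreover have "y \<in> nbrs adj x" if "x = last g" using that g by (simp add: nbrs_def)
  ultimately show ?case using Suc.IH[OF g(1)] g(2) by (auto split: if_splits)
qed auto

lemma low_count_le:
  assumes "h @ [y] \<in> paths N" "low k (h @ [y])"
  shows "count_list h y \<le> D * k"
proof -
  have "(\<Sum>z\<in>nbrs adj y. count_list (h @ [y]) z) \<le> card (nbrs adj y) * k"
    using assms(2) sum_bounded_above[of "nbrs adj y" "count_list (h @ [y])" k]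
    by (simp add: low_def less_imp_le del: count_list_append)
  also have "\<dots> \<le> D * k" using degree by (intro mult_right_mono) auto
  \<comment> \<open>The extra 1 in \<open>count_le\<close> is the visit just made to y, which
    \<open>h\<close> does not contain.\<close>
  finally show ?thesis using count_le[OF assms(1), of y] by simp
qed

section \<open>Steps from high times to rarely visited sites\<close>

text \<open>The part of \<open>tail k\<close> that each site has used up, rather than the part that
  remains: unvisited sites then contribute 0, and the sum over visited sites is an increasing
  potential.\<close>

definition tail_weight :: "nat \<Rightarrow> 'a list \<Rightarrow> real" where
  "tail_weight k h = (\<Sum>v\<in>set h. \<Sum>j\<in>{k..<count_list h v}. 1 / w j)"

lemma tail_weight_le: "tail_weight k h \<le> tail k * card (set h)"
  unfolding tail_weight_def
  using sum_bounded_above[of "set h" "\<lambda>v. \<Sum>j\<in>{k..<count_list h v}. 1 / w j" "tail k"] sum_le_tail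
  by (simp add: mult.commute)

lemma tail_weight_nonneg: "tail_weight k h \<ge> 0"
  unfolding tail_weight_def by (intro sum_nonneg) (use w_pos in \<open>auto intro: less_imp_le\<close>)

lemma tail_weight_snoc:
  "tail_weight k (h @ [y]) = tail_weight k h + (if k \<le> count_list h y then 1 / w (count_list h y) else 0)"
proof -
  let ?g = "\<lambda>h v. \<Sum>j\<in>{k..<count_list h v}. 1 / w j"
  have "tail_weight k h = (\<Sum>v\<in>insert y (set h). ?g h v)"
    unfolding tail_weight_def
    by (intro sum.mono_neutral_left) auto
  moreover have "tail_weight k (h @ [y]) = (\<Sum>v\<in>insert y (set h).
      ?g h v + (if v = y then (if k \<le> count_list h y then 1 / w (count_list h y) else 0) else 0))"
    unfolding tail_weight_def by (intro sum.cong) auto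
  ultimately show ?thesis by (simp add: sum.distrib)
qed

text \<open>The count is taken before the step, so j = 0 singles out the discovery of a new
  site.\<close>

definition descents :: "nat \<Rightarrow> nat \<Rightarrow> 'a list \<Rightarrow> 'a \<Rightarrow> real" where
  "descents k j h y = of_bool (\<not> low k h \<and> count_list h y \<le> j)"

text \<open>At a k-high time some neighbour has at least k visits, so the drift of
  \<open>tail_weight k\<close> is at least 1/S, with S the local weight. At most D neighbours have
  at most j visits, each chosen with probability at most (w 0 + ... + w j)/S. The constant in front
  of \<open>tail k\<close> is free of k, so a large k makes the bound a small multiple of the mean
  range.\<close>

lemma mean_descents_le:
  "path_mean N (path_sum (descents k j)) \<le>
     D * (\<Sum>i\<le>j. w i) * tail k * path_mean N (\<lambda>h. card (set h))"
proof -
  let ?C = "D * (\<Sum>i\<le>j. w i)"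
  have C0: "?C \<ge> 0" using w_pos by (intro mult_nonneg_nonneg sum_nonneg) (auto intro: less_imp_le)
  have "path_mean N (path_sum (descents k j)) \<le> path_mean N (\<lambda>h. ?C * tail_weight k h)"
  proof (rule path_mean_path_sum_le)
    fix N h assume h: "h \<in> paths N"
    let ?N = "nbrs adj (last h)" and ?S = "local_weight h"
    have S: "?S > 0" by (rule local_weight_pos)
    have "step_mean (\<lambda>h y. ?C * tail_weight k (h @ [y])) h - ?C * tail_weight k h
        = ?C * step_mean (\<lambda>h y. if k \<le> count_list h y then 1 / w (count_list h y) else 0) h"
      by (simp only: tail_weight_snoc step_mean_cmult step_mean_add step_mean_const) (simp add: algebra_simps)
    \<comment> \<open>The weight of y cancels: y is chosen with probability w(Z(y))/S and then adds
      1/w(Z(y)).\<close>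
    also have "step_mean (\<lambda>h y. if k \<le> count_list h y then 1 / w (count_list h y) else 0) h
        = (\<Sum>y\<in>?N. if k \<le> count_list h y then 1 / ?S else 0)"
      unfolding step_mean_def
    proof (intro sum.cong)
      fix y assume "y \<in> ?N"
      then show "vrrw_step adj w h y * (if k \<le> count_list h y then 1 / w (count_list h y) else 0)
        = (if k \<le> count_list h y then 1 / ?S else 0)"
        using w_pos[of "count_list h y"] by (simp add: step_eq)
    qed simp
    finally have eq: "step_mean (\<lambda>h y. ?C * tail_weight k (h @ [y])) h - ?C * tail_weight k h
      = ?C * (\<Sum>y\<in>?N. if k \<le> count_list h y then 1 / ?S else 0)" .
    show "step_mean (descents k j) h
      \<le> step_mean (\<lambda>h y. ?C * tail_weight k (h @ [y])) h - ?C * tail_weight k h"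
    proof (cases "low k h")
      case True
      then have "step_mean (descents k j) h = 0" by (simp add: step_mean_def descents_def)
      moreover have "(\<Sum>y\<in>?N. if k \<le> count_list h y then 1 / ?S else 0) \<ge> 0"
        using S by (intro sum_nonneg) auto
      ultimately show ?thesis unfolding eq using C0 by simp
    next
      case False
      then obtain z where z: "z \<in> ?N" "k \<le> count_list h z" by (auto simp: low_def not_less)
      have "1 / ?S = (if k \<le> count_list h z then 1 / ?S else 0)" using z by simp
      also have "\<dots> \<le> (\<Sum>y\<in>?N. if k \<le> count_list h y then 1 / ?S else 0)"
        using S z by (intro member_le_sum) (auto simp: loc_finite)
      finally have 1: "?C * (1 / ?S) \<le> ?C * (\<Sum>y\<in>?N. if k \<le> count_list h y then 1 / ?S else 0)"
        using C0 by (rule mult_left_mono)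
      have "step_mean (descents k j) h \<le> (\<Sum>y\<in>?N. (\<Sum>i\<le>j. w i) / ?S)"
        unfolding step_mean_def
      proof (rule sum_mono)
        fix y assume y: "y \<in> ?N"
        have "w (count_list h y) \<le> (\<Sum>i\<le>j. w i)" if "count_list h y \<le> j"
          using that w_pos by (intro member_le_sum) (auto intro: less_imp_le)
        moreover have "(\<Sum>i\<le>j. w i) \<ge> 0" using w_pos by (intro sum_nonneg) (auto intro: less_imp_le)
        ultimately show "vrrw_step adj w h y * descents k j h y \<le> (\<Sum>i\<le>j. w i) / ?S"
          using S y by (auto simp: step_eq descents_def intro: divide_right_mono)
      qed
      also have "\<dots> \<le> ?C * (1 / ?S)"
        using S degree[of "last h"] w_pos
        by (simp, intro divide_right_mono mult_right_mono sum_nonneg) (auto intro: less_imp_le)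
      finally show ?thesis unfolding eq using 1 by linarith
    qed
  qed (use C0 tail_weight_nonneg in auto)
  also have "\<dots> \<le> path_mean N (\<lambda>h. ?C * tail k * card (set h))"
  proof (rule path_mean_mono)
    fix h
    show "?C * tail_weight k h \<le> ?C * tail k * card (set h)"
      using mult_left_mono[OF tail_weight_le C0] by (simp only: mult.assoc)
  qed
  also have "\<dots> = ?C * tail k * path_mean N (\<lambda>h. card (set h))"
    by (rule path_mean_cmult)
  finally show ?thesis .
qed

section \<open>Low pairs and trapping on an edge\<close>

definition low_pair :: "nat \<Rightarrow> 'a list \<Rightarrow> 'a \<Rightarrow> real" where
  "low_pair k h y = of_bool (low k h \<and> low k (h @ [y]))"

text \<open>
  The streak of h counts the times t at which a low pair is completed and from which h alternates
  between two sites up to its end; streak_rev works on the reversed history.  It stays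
  bounded since alternation soon makes the neighbour counts large.
\<close>
fun streak_rev :: "nat \<Rightarrow> 'a list \<Rightarrow> nat" where
  "streak_rev k (y # x # r) =
     (if r \<noteq> [] \<and> y = hd r then streak_rev k (x # r) else 0)
     + of_bool (low k (rev (x # r)) \<and> low k (rev (y # x # r)))"
| "streak_rev k r = 0"

definition streak :: "nat \<Rightarrow> 'a list \<Rightarrow> nat" where
  "streak k h = streak_rev k (rev h)"

text \<open>For a one-site history this is \<open>last []\<close>, an unspecified value; hence the
  guards \<open>butlast h \<noteq> []\<close>.\<close>

abbreviation "prev h \<equiv> last (butlast h)"

lemma streak_single: "streak k [x] = 0"
  by (simp add: streak_def)

lemma streak_snoc:
  assumes "h \<noteq> []"
  shows "streak k (h @ [y]) =
    (if butlast h \<noteq> [] \<and> y = prev h then streak k h else 0) + of_bool (low k h \<and> low k (h @ [y]))"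
proof -
  obtain g x where "h = g @ [x]" using assms by (metis append_butlast_last_id)
  then show ?thesis by (simp add: streak_def hd_rev)
qed

text \<open>A positive streak goes back to a low pair, at which all neighbours of both sites have
  fewer than k visits. The alternation since then has raised only the counts of the two sites
  themselves, by one per step.\<close>

lemma streak_invariant:
  assumes "h \<in> paths N" "streak k h > 0"
  shows "butlast h \<noteq> [] \<and> adj (prev h) (last h)
    \<and> (\<forall>z\<in>nbrs adj (last h). z \<noteq> prev h \<longrightarrow> count_list h z < k)
    \<and> (\<forall>z\<in>nbrs adj (prev h). z \<noteq> last h \<longrightarrow> count_list h z < k)
    \<and> streak k h \<le> count_list h (last h) + count_list h (prev h)
    \<and> streak k h \<le> 2 * k"
  using assms
proof (induction N arbitrary: h)
  case 0
  then show ?case by (simp add: streak_single)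
next
  case (Suc N)
  then obtain g y where g: "g \<in> paths N" and h: "h = g @ [y]" and xy: "adj (last g) y"
    by (auto simp: nbrs_def)
  define x where "x = last g"
  have gne: "g \<noteq> []" using paths_not_Nil[OF g] .
  have ne: "x \<noteq> y" using xy irrefl x_def by auto
  have lst: "last h = y" "prev h = x" "butlast h \<noteq> []" using h gne x_def by auto
  have cx: "count_list h x = count_list g x" using ne h by simp
  have cy: "count_list h y = Suc (count_list g y)" using h by simp
  have co: "count_list h z = count_list g z" if "z \<noteq> y" for z using h that by simp
  have lowxy: "count_list g x < k \<and> count_list g y < k" if "low k g" "low k h"
    using that xy sym[OF xy] cx by (auto simp: low_def nbrs_def lst x_def)
  show ?case
  proof (cases "butlast g \<noteq> [] \<and> y = prev g \<and> streak k g > 0")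
    case True
    then have y: "y = prev g" by simp
    note IH = Suc.IH[OF g, folded x_def]
    have IH': "\<forall>z\<in>nbrs adj x. z \<noteq> y \<longrightarrow> count_list g z < k"
        "\<forall>z\<in>nbrs adj y. z \<noteq> x \<longrightarrow> count_list g z < k"
        "streak k g \<le> count_list g x + count_list g y" "streak k g \<le> 2 * k"
      using IH True by (auto simp: x_def[symmetric])
    have st: "streak k h = streak k g + of_bool (low k g \<and> low k h)"
      using streak_snoc[OF gne, of k y] True h by simp
    have "count_list h z < k" if "z \<in> nbrs adj y" "z \<noteq> x" for z
    proof -
      have "z \<noteq> y" using that(1) irrefl[of y] by (auto simp: nbrs_def)
      then show ?thesis using that IH'(2) co[of z] by simp
    qed
    moreover have "count_list h z < k" if "z \<in> nbrs adj x" "z \<noteq> y" for z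
      using that IH'(1) co[of z] by auto
    moreover have "streak k h \<le> count_list h y + count_list h x"
      using st IH'(3) cx cy by simp
    \<comment> \<open>If the streak grows, both sites had fewer than k visits in \<open>g\<close>,
      and the streak of \<open>g\<close> is at most the sum of these two counts.\<close>
    moreover have "streak k h \<le> 2 * k"
      using st IH'(3,4) lowxy by (cases "low k g \<and> low k h") auto
    ultimately show ?thesis using lst xy x_def by simp
  next
    case False
    \<comment> \<open>No earlier streak survives, so a positive streak means that this very step
      completes a low pair.\<close>
    then have st: "streak k h = of_bool (low k g \<and> low k h)"
      using streak_snoc[OF gne, of k y] h by auto
    then have l: "low k g" "low k h" using Suc.prems(2) by (auto split: if_splits)
    have "count_list h z < k" if "z \<in> nbrs adj y" for z
      using that l(2) lst by (simp add: low_def)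
    moreover have "count_list h z < k" if "z \<in> nbrs adj x" "z \<noteq> y" for z
      using that l(1) co[of z] by (simp add: low_def x_def)
    moreover have "k > 0" using lowxy l by auto
    ultimately show ?thesis using lst xy x_def st l cy by simp
  qed
qed

definition trap_rate :: "nat \<Rightarrow> real" where
  "trap_rate k = D * (\<Sum>i<k. w i)"

text \<open>
  A lower bound for the probability of alternating for ever once the streak of h is positive: the
  competing neighbours contribute at most trap_rate k to each normalising sum, and
  a / (a + b) is at least exp (- b / a).
\<close>
definition trap_bound :: "nat \<Rightarrow> 'a list \<Rightarrow> real" where
  "trap_bound k h = exp (- trap_rate k * (tail (count_list h (last h)) + tail (count_list h (prev h))))"

definition trap_const :: "nat \<Rightarrow> real" where
  "trap_const k = exp (- trap_rate k * (2 * tail 0))"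

lemma trap_rate_nonneg: "trap_rate k \<ge> 0"
  unfolding trap_rate_def using w_pos by (intro mult_nonneg_nonneg sum_nonneg) (auto intro: less_imp_le)

lemma trap_bound_ge: "trap_const k \<le> trap_bound k h"
proof -
  have "tail (count_list h (last h)) + tail (count_list h (prev h)) \<le> 2 * tail 0"
    unfolding mult_2 by (intro add_mono tail_le) simp_all
  from mult_left_mono[OF this trap_rate_nonneg] show ?thesis
    unfolding trap_const_def trap_bound_def by simp
qed

lemma trap_bound_le_1: "trap_bound k h \<le> 1"
  unfolding trap_bound_def using trap_rate_nonneg tail_nonneg by (simp add: mult_nonneg_nonneg)

text \<open>With W the weight of the previous site, returning to it has probability at least W / (W
  + \<open>trap_rate k\<close>), hence at least exp (- \<open>trap_rate k\<close> / W). The return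
  removes 1/W from the tail of that site, which multiplies \<open>trap_bound\<close> by exactly the
  inverse factor.\<close>

lemma return_step:
  assumes h: "h \<in> paths N" and pos: "streak k h > 0"
  shows "prev h \<in> nbrs adj (last h)"
    and "trap_bound k h \<le> vrrw_step adj w h (prev h) * trap_bound k (h @ [prev h])"
proof -
  define a b where "a = prev h" and "b = last h"
  have inv: "butlast h \<noteq> []" "adj a b" "\<forall>z\<in>nbrs adj b. z \<noteq> a \<longrightarrow> count_list h z < k"
    using streak_invariant[OF h pos] by (auto simp: a_def b_def)
  have ne: "a \<noteq> b" using inv(2) irrefl by auto
  show nb: "prev h \<in> nbrs adj (last h)" using sym[OF inv(2)] by (simp add: nbrs_def a_def b_def)
  define W where "W = w (count_list h a)"
  have W: "W > 0" using w_pos by (simp add: W_def)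
  have "local_weight h = W + (\<Sum>z\<in>nbrs adj b - {a}. w (count_list h z))"
    unfolding local_weight_def W_def using nb loc_finite by (simp add: sum.remove a_def b_def)
  also have "(\<Sum>z\<in>nbrs adj b - {a}. w (count_list h z)) \<le> (\<Sum>z\<in>nbrs adj b - {a}. \<Sum>i<k. w i)"
  proof (rule sum_mono)
    fix z assume "z \<in> nbrs adj b - {a}"
    then have "count_list h z < k" using inv(3) by auto
    then show "w (count_list h z) \<le> (\<Sum>i<k. w i)"
      using w_pos by (intro member_le_sum) (auto intro: less_imp_le)
  qed
  also have "\<dots> \<le> trap_rate k"
  proof -
    have "card (nbrs adj b - {a}) \<le> D"
      using degree[of b] card_Diff1_le[of "nbrs adj b" a] by linarith
    then show ?thesis unfolding trap_rate_def using w_pos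
      by (simp, intro mult_right_mono sum_nonneg) (auto intro: less_imp_le)
  qed
  finally have lw: "local_weight h \<le> W + trap_rate k" by simp
  have tb: "trap_bound k (h @ [a]) = trap_bound k h * exp (trap_rate k / W)"
  proof -
    have "trap_bound k (h @ [a]) = exp (- trap_rate k * (tail (Suc (count_list h a)) + tail (count_list h b)))"
      using paths_not_Nil[OF h] ne by (simp add: trap_bound_def b_def)
    moreover have "trap_bound k h = exp (- trap_rate k * (tail (count_list h b) + tail (count_list h a)))"
      by (simp add: trap_bound_def a_def b_def)
    ultimately show ?thesis
      using tail_Suc[of "count_list h a"] by (simp add: W_def exp_add[symmetric] algebra_simps)
  qed
  have "local_weight h \<le> W * (1 + trap_rate k / W)" using lw W by (simp add: distrib_left)
  also have "\<dots> \<le> W * exp (trap_rate k / W)" using W by (intro mult_left_mono exp_ge_add_one_self) auto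
  finally have "1 \<le> W / local_weight h * exp (trap_rate k / W)"
    using local_weight_pos[of h] by (simp add: field_simps)
  from mult_left_mono[OF this, of "trap_bound k h"]
  have "trap_bound k h \<le> W / local_weight h * (trap_bound k h * exp (trap_rate k / W))"
    by (simp add: trap_bound_def mult_ac)
  moreover have "vrrw_step adj w h a = W / local_weight h"
    using nb by (simp add: step_eq W_def a_def)
  ultimately show "trap_bound k h \<le> vrrw_step adj w h (prev h) * trap_bound k (h @ [prev h])"
    using tb by (simp add: a_def)
qed

text \<open>The potential is the streak times \<open>trap_bound\<close>. By
  \<open>return_step\<close> the returns alone preserve its mean, even if the streak is lost at
  every other step. Each low pair adds at least \<open>trap_const k\<close>, while the potential
  never exceeds 2 * k.\<close>

lemma mean_low_pair_le:
  "path_mean N (path_sum (low_pair k)) \<le> 2 * k / trap_const k"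
proof -
  let ?d = "trap_const k" and ?F = "\<lambda>h. streak k h * trap_bound k h"
  have d: "?d > 0" by (simp add: trap_const_def)
  have tb: "trap_bound k h > 0" for h by (simp add: trap_bound_def)
  have "path_mean N (path_sum (low_pair k)) \<le> path_mean N (\<lambda>h. 1 / ?d * ?F h)"
  proof (rule path_mean_path_sum_le)
    fix N h assume h: "h \<in> paths N"
    let ?N = "nbrs adj (last h)"
    \<comment> \<open>The share of the next potential that is inherited from the old streak.\<close>
    let ?r = "\<lambda>h y. of_bool (butlast h \<noteq> [] \<and> y = prev h) * (streak k h * trap_bound k (h @ [y]))"
    have hne: "h \<noteq> []" using paths_not_Nil[OF h] .
    have ret: "?F h \<le> step_mean ?r h"
    proof (cases "streak k h > 0")
      case True
      note rs = return_step[OF h True]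
      have ne: "butlast h \<noteq> []" using streak_invariant[OF h True] by simp
      have "?F h \<le> vrrw_step adj w h (prev h) * ?r h (prev h)"
        using mult_left_mono[OF rs(2), of "real (streak k h)"] ne by (simp add: mult_ac)
      also have "\<dots> \<le> step_mean ?r h"
        unfolding step_mean_def
        using rs(1) tb by (intro member_le_sum) (auto intro!: mult_nonneg_nonneg step_nonneg loc_finite less_imp_le)
      finally show ?thesis .
    next
      case False
      then show ?thesis by (simp add: step_mean_def)
    qed
    have "?F h + ?d * step_mean (low_pair k) h \<le> step_mean (\<lambda>h y. ?r h y + ?d * low_pair k h y) h"
      using ret by (simp add: step_mean_add step_mean_cmult)
    also have "\<dots> \<le> step_mean (\<lambda>h y. ?F (h @ [y])) h"
    proof (rule step_mean_mono)
      fix y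
      have "?d * low_pair k h y \<le> low_pair k h y * trap_bound k (h @ [y])"
        using trap_bound_ge by (simp add: low_pair_def)
      moreover have "?F (h @ [y]) = ?r h y + low_pair k h y * trap_bound k (h @ [y])"
        using streak_snoc[OF hne, of k y] by (simp add: low_pair_def algebra_simps)
      ultimately show "?r h y + ?d * low_pair k h y \<le> ?F (h @ [y])" by linarith
    qed
    finally have "?d * step_mean (low_pair k) h \<le> step_mean (\<lambda>h y. ?F (h @ [y])) h - ?F h" by simp
    then have "step_mean (low_pair k) h \<le> 1 / ?d * (step_mean (\<lambda>h y. ?F (h @ [y])) h - ?F h)"
      using d by (simp add: field_simps)
    then show "step_mean (low_pair k) h \<le> step_mean (\<lambda>h y. 1 / ?d * ?F (h @ [y])) h - 1 / ?d * ?F h"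
      by (simp only: step_mean_cmult right_diff_distrib)
  qed (simp add: streak_single)
  also have "\<dots> \<le> path_mean N (\<lambda>h. 2 * k / ?d)"
  proof (rule path_mean_mono)
    fix h assume h: "h \<in> paths N"
    have "real (streak k h) \<le> 2 * k"
      using streak_invariant[OF h, of k] by (cases "streak k h > 0") auto
    then have "?F h \<le> real (2 * k) * 1"
      using trap_bound_le_1 tb[of h] by (intro mult_mono) auto
    then show "1 / ?d * ?F h \<le> 2 * k / ?d" using d by (simp add: field_simps)
  qed
  also have "\<dots> = 2 * k / ?d" by (rule path_mean_const)
  finally show ?thesis by simp
qed

section \<open>Bounding the mean number of visited sites\<close>

text \<open>
  The indicator of being k-high stores the steps from k-low to l-high times whose return to a
  k-low time is still to come.
\<close>
lemma card_set_le:
  assumes "k \<le> l" "h \<in> paths N"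
  shows "real (card (set h)) \<le> 1 + of_bool (\<not> low k h) + 2 * path_sum (low_pair l) h
    + path_sum (descents k 0) h + path_sum (descents l (D * k)) h"
  using assms(2)
proof (induction N arbitrary: h)
  case 0
  then show ?case by (simp add: path_sum_single)
next
  case (Suc N)
  then obtain g y where g: "g \<in> paths N" and h: "h = g @ [y]" by auto
  have gne: "g \<noteq> []" using paths_not_Nil[OF g] .
  have low_mono: "low k g' \<Longrightarrow> low l g'" for g' using assms(1) by (auto simp: low_def)
  have "real (card (set h)) = card (set g) + of_bool (count_list g y = 0)"
    using h by (auto simp: count_list_0_iff card_insert_if)
  \<comment> \<open>A discovery from a k-high time is a descent to count 0. One from a k-low time
    gives an l-low pair or makes \<open>h\<close> l-high, hence k-high, which raises the stored
    indicator. Passing from k-high to k-low releases the indicator: this is an l-low pair, or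
    \<open>g\<close> is l-high and \<open>low_count_le\<close> bounds the count of y by D *
    k.\<close>
  moreover have "of_bool (count_list g y = 0) + of_bool (\<not> low k g)
    \<le> of_bool (\<not> low k h) + 2 * low_pair l g y + descents k 0 g y + descents l (D * k) g y"
    using low_mono low_count_le[of g y "Suc N" k] Suc.prems h
    by (auto simp: low_pair_def descents_def)
  ultimately show ?case
    using Suc.IH[OF g] path_sum_snoc[OF gne] h by (simp add: algebra_simps)
qed

lemma mean_card_bounded: "\<exists>B. \<forall>N. path_mean N (\<lambda>h. card (set h)) \<le> B"
proof -
  have small: "\<exists>k\<ge>m. c * tail k \<le> 1/4" for m c
  proof -
    have "(\<lambda>k. c * tail k) \<longlonglongrightarrow> c * 0" by (intro tendsto_intros tail_tendsto)
    then have "\<forall>\<^sub>F k in sequentially. c * tail k < 1/4" by (rule order_tendstoD) simp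
    then obtain K where "\<And>k. k \<ge> K \<Longrightarrow> c * tail k < 1/4" by (auto simp: eventually_sequentially)
    then show ?thesis by (intro exI[of _ "max K m"]) (auto intro: less_imp_le)
  qed
  \<comment> \<open>k is fixed first, because the constant that \<open>tail l\<close> has to beat
    contains the weights up to D * k.\<close>
  obtain k where k: "D * (\<Sum>i\<le>0. w i) * tail k \<le> 1/4" using small by blast
  obtain l where l: "k \<le> l" "D * (\<Sum>i\<le>D * k. w i) * tail l \<le> 1/4" using small by blast
  let ?V = "2 * l / trap_const l"
  have "path_mean N (\<lambda>h. card (set h)) \<le> 4 + 4 * ?V" for N
  proof -
    let ?R = "path_mean N (\<lambda>h. card (set h))"
    have R: "?R \<ge> 0" using path_mean_mono[of N "\<lambda>h. 0" "\<lambda>h. card (set h)"] by (simp add: path_mean_const)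
    have "?R \<le> path_mean N (\<lambda>h. 2 + 2 * path_sum (low_pair l) h
        + path_sum (descents k 0) h + path_sum (descents l (D * k)) h)"
    proof (rule path_mean_mono)
      fix h assume "h \<in> paths N"
      from card_set_le[OF l(1) this] show "real (card (set h)) \<le> 2 + 2 * path_sum (low_pair l) h
        + path_sum (descents k 0) h + path_sum (descents l (D * k)) h"
        by (cases "low k h") simp_all
    qed
    also have "\<dots> = 2 + 2 * path_mean N (path_sum (low_pair l)) + path_mean N (path_sum (descents k 0))
        + path_mean N (path_sum (descents l (D * k)))"
      by (simp add: path_mean_add path_mean_cmult path_mean_const)
    also have "\<dots> \<le> 2 + 2 * ?V + 1/4 * ?R + 1/4 * ?R"
      using mean_low_pair_le[of N l]
        order_trans[OF mean_descents_le mult_right_mono[OF k R]]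
        order_trans[OF mean_descents_le mult_right_mono[OF l(2) R]]
      by linarith
    \<comment> \<open>For each N the mean is a finite sum, so half of it may be subtracted from both
      sides.\<close>
    finally show ?thesis by linarith
  qed
  then show ?thesis by blast
qed

section \<open>From the mean bound to almost sure finiteness\<close>

text \<open>Markov's inequality bounds the probability of more than r sites by B / r, uniformly in
  time; then time tends to infinity, and after it r.\<close>

lemma AE_finite_range:
  assumes "is_vrrw M adj w x0 X"
  shows "AE \<omega> in M. finite (range (\<lambda>n. X n \<omega>))"
proof -
  interpret prob_space M using assms by (simp add: is_vrrw_def)
  have X [measurable]: "X n \<in> measurable M (count_space UNIV)" for n
    using assms by (simp add: is_vrrw_def)
  define cyl where "cyl xs = {\<omega> \<in> space M. \<forall>k<length xs. X k \<omega> = xs ! k}" for xs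
  have cyl_sets [measurable]: "cyl xs \<in> sets M" for xs
    unfolding cyl_def by measurable
  have cyl_prob: "prob (cyl xs) = vrrw_path_prob adj w x0 xs" if "xs \<noteq> []" for xs
    using assms that by (simp add: is_vrrw_def cyl_def)
  \<comment> \<open>Walks in \<open>paths N\<close> with at most r sites: a finite disjoint union of
    cylinders, so its probability follows from the cylinder probabilities in
    \<open>is_vrrw\<close>.\<close>
  define G where "G r N = (\<Union>xs\<in>{xs\<in>paths N. card (set xs) \<le> r}. cyl xs)" for r N
  have G_iff: "\<omega> \<in> G r N \<longleftrightarrow> \<omega> \<in> space M \<and> map (\<lambda>k. X k \<omega>) [0..<Suc N] \<in> paths N
      \<and> card ((\<lambda>k. X k \<omega>) ` {..N}) \<le> r" for \<omega> r N
  proof -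
    have "\<omega> \<in> cyl xs \<longleftrightarrow> \<omega> \<in> space M \<and> xs = map (\<lambda>k. X k \<omega>) [0..<Suc N]" if "xs \<in> paths N" for xs
      using length_paths[OF that] by (auto simp: cyl_def list_eq_iff_nth_eq simp del: upt_Suc)
    moreover have "set (map (\<lambda>k. X k \<omega>) [0..<Suc N]) = (\<lambda>k. X k \<omega>) ` {..N}"
      by (simp only: set_map set_upt atLeast0LessThan lessThan_Suc_atMost)
    ultimately show ?thesis unfolding G_def by auto
  qed
  have G_sets [measurable]: "G r N \<in> sets M" for r N
    unfolding G_def using finite_paths by (intro sets.finite_UN) auto
  obtain B where B: "\<And>N. path_mean N (\<lambda>h. card (set h)) \<le> B" using mean_card_bounded by blast
  have G_prob: "prob (G r N) \<ge> 1 - B / r" if "r > 0" for r N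
  proof -
    have "prob (G r N) = (\<Sum>xs\<in>{xs\<in>paths N. card (set xs) \<le> r}. prob (cyl xs))"
      unfolding G_def
    proof (rule finite_measure_finite_Union)
      show "disjoint_family_on cyl {xs \<in> paths N. card (set xs) \<le> r}"
        by (auto simp: disjoint_family_on_def cyl_def list_eq_iff_nth_eq dest!: length_paths)
    qed (auto simp: finite_paths)
    also have "\<dots> = (\<Sum>xs\<in>{xs\<in>paths N. card (set xs) \<le> r}. vrrw_path_prob adj w x0 xs)"
      by (intro sum.cong) (auto simp: cyl_prob paths_not_Nil)
    also have "\<dots> = path_mean N (\<lambda>h. of_bool (card (set h) \<le> r))"
      unfolding path_mean_def by (simp add: finite_paths sum.inter_filter of_bool_def if_distrib cong: if_cong)
    finally have "prob (G r N) = path_mean N (\<lambda>h. of_bool (card (set h) \<le> r))" .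
    \<comment> \<open>Markov's inequality in pointwise form: either at most r sites are visited, or
      their number divided by r is at least 1.\<close>
    moreover have "path_mean N (\<lambda>h. 1) \<le> path_mean N (\<lambda>h. of_bool (card (set h) \<le> r) + 1 / r * card (set h))"
      using that by (intro path_mean_mono) (auto simp: field_simps)
    moreover have "1 / r * path_mean N (\<lambda>h. card (set h)) \<le> B / r"
      using B[of N] that by (simp add: divide_right_mono)
    ultimately show ?thesis
      unfolding path_mean_add path_mean_cmult path_mean_const by linarith
  qed
  have decs: "decseq (G r)" for r
  proof (rule decseq_SucI)
    fix N show "G r (Suc N) \<subseteq> G r N"
    proof
      fix \<omega> assume \<omega>: "\<omega> \<in> G r (Suc N)"
      then have "take (Suc N) (map (\<lambda>k. X k \<omega>) [0..<Suc (Suc N)]) \<in> paths N"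
        by (intro take_paths[of _ "Suc N"]) (auto simp: G_iff simp del: upt_Suc)
      then have "map (\<lambda>k. X k \<omega>) [0..<Suc N] \<in> paths N"
        by (simp add: take_map del: upt_Suc)
      moreover have "card ((\<lambda>k. X k \<omega>) ` {..N}) \<le> card ((\<lambda>k. X k \<omega>) ` {..Suc N})"
        by (intro card_mono) auto
      ultimately show "\<omega> \<in> G r N" using \<omega> by (simp add: G_iff del: upt_Suc)
    qed
  qed
  define F where "F = (\<Union>r. \<Inter>N. G r N)"
  have F_sets [measurable]: "F \<in> sets M" unfolding F_def by measurable
  have F_ge: "1 - B / real r \<le> prob F" if "r > 0" for r :: nat
  proof -
    have "(\<lambda>N. prob (G r N)) \<longlonglongrightarrow> prob (\<Inter>N. G r N)"
      using decs by (intro finite_Lim_measure_decseq) auto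
    then have "1 - B / r \<le> prob (\<Inter>N. G r N)"
      using G_prob[OF that] by (intro LIMSEQ_le_const) auto
    also have "\<dots> \<le> prob F" by (intro finite_measure_mono) (auto simp: F_def)
    finally show ?thesis .
  qed
  have "(\<lambda>r. 1 - B / real r) \<longlonglongrightarrow> 1 - 0"
    by (intro tendsto_diff tendsto_const lim_const_over_n)
  then have "1 \<le> prob F"
    using F_ge by (intro LIMSEQ_le_const2[of _ 1]) (auto intro!: exI[of _ 1])
  then have "AE \<omega> in M. \<omega> \<in> F"
    using prob_le_1[of F] by (intro AE_prob_1) simp
  then show ?thesis
  proof (rule AE_mp, intro AE_I2 impI)
    fix \<omega> assume "\<omega> \<in> F"
    then obtain r where r: "\<And>N. card ((\<lambda>k. X k \<omega>) ` {..N}) \<le> r"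
      by (auto simp: F_def G_iff)
    show "finite (range (\<lambda>n. X n \<omega>))"
    proof (rule ccontr)
      assume "infinite (range (\<lambda>n. X n \<omega>))"
      \<comment> \<open>Some r + 1 distinct sites would all have been visited by the finite time
        \<open>Max I\<close>, contrary to the bound r.\<close>
      then obtain A where A: "A \<subseteq> range (\<lambda>n. X n \<omega>)" "finite A" "card A = Suc r"
        using infinite_arbitrarily_large by blast
      then obtain I where I: "finite I" "A = (\<lambda>n. X n \<omega>) ` I"
        by (meson finite_subset_image)
      then have "A \<subseteq> (\<lambda>k. X k \<omega>) ` {..Max I}" by auto
      from card_mono[OF _ this] A(3) r[of "Max I"] show False by simp
    qed
  qed
qed

end

theorem theorem5p1:
  fixes adj :: "'a \<Rightarrow> 'a \<Rightarrow> bool" and w :: "nat \<Rightarrow> real" and x0 :: 'a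
    and M :: "'m measure" and X :: "nat \<Rightarrow> 'm \<Rightarrow> 'a"
  assumes sym: "\<And>x y. adj x y \<Longrightarrow> adj y x"
    and irrefl: "\<And>x. \<not> adj x x"
    and loc_finite: "\<And>x. finite (nbrs adj x)"
    and has_nbr: "\<And>x. nbrs adj x \<noteq> {}"
    and bounded_degree: "\<exists>D::nat. \<forall>x. card (nbrs adj x) \<le> D"
    and w_pos: "\<And>n. w n > 0"
    and summable: "summable (\<lambda>n. 1 / w n)"
    and vrrw: "is_vrrw M adj w x0 X"
  shows "AE \<omega> in M. finite (range (\<lambda>n. X n \<omega>))"
proof -
  obtain D where "\<And>x. card (nbrs adj x) \<le> D" using bounded_degree by blast
  then interpret reinforced_walk adj w x0 D
    using sym irrefl loc_finite has_nbr w_pos summable by unfold_locales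
  show ?thesis using vrrw by (rule AE_finite_range)
qed

end
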